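(* Let $A=(a_{ij})$ be a real $n\times n$ matrix satisfying $$a_{ii} \geq a_{i,i+1} \geq \dots \geq a_{in} \geq a_{i1} \geq \dots \geq a_{i,i-1}, \qquad i=1,\dots,n,$$ and suppose that the directed graph $\mathscr{G}(A)$ has at least two closed strongly connected components, or has exactly one closed strongly connected component and that component is null. Then $A$ is singular.
   Context: The directed graph $\mathscr{G}(A)$ has vertex set $\{1,\dots,n\}$ and a directed edge from $i$ to $j$ if and only if $\kappa_{ij}=1$, where $\kappa_{ij}:=1$ if ($j=1$ and $a_{in}>a_{i1}$) or ($2\leq j\leq n$ and $a_{i,j-1}>a_{ij}$), and $\kappa_{ij}:=0$ otherwise. Two distinct vertices $i,j$ are strongly connected if there are directed paths in $\mathscr{G}(A)$ from $i$ to $j$ and from $j$ to $i$; every vertex is declared strongly connected to itself. The equivalence classes of this relation are the strongly connected components (SCCs). An SCC $C$ is open if there is a directed edge from a vertex in $C$ to a vertex not in $C$, and closed otherwise. For $I,J\subseteq\{1,\dots,n\}$, $[A]_{IJ}$ denotes the submatrix with rows indexed by $I$ and columns indexed by $J$, $[A]^{\top}_{IJ}$ is the transpose of $[A]_{IJ}$, and $[x]_I$ is the subvector of $x$ with components indexed by $I$. $e$ is the vector of all ones. A closed SCC $C$ of $\mathscr{G}(A)$, with $C^c:=\{1,\dots,n\}\setminus C$, is called fundamental if the system $[A]^{\top}_{CC}[x]_C=[e]_C$, $[x]_{C^c}=0$ has a solution $x\in\mathbb{R}^n$, and is called null if this system has no solution. *)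

theory Defs
  imports
    Jordan_Normal_Form.DL_Submatrix
    Jordan_Normal_Form.Determinant
    Graph_Theory.Digraph_Component
begin

text \<open>
  Matrix rows, matrix columns and graph vertices are numbered from 0 to n - 1, as usual for
  the matrix library, so index i here stands for i + 1 in the numbering from 1 to n.
\<close>

text \<open>
  In row i the chain of inequalities starts at the diagonal and runs cyclically up to
  column i - 1. The part that wraps around is empty for the first row, so no relation
  between its last and its first entry is imposed.
\<close>

definition cyclically_decreasing_rows :: "real mat \<Rightarrow> bool" where
  "cyclically_decreasing_rows A \<longleftrightarrow>
     (\<forall>i < dim_row A. sorted_wrt (\<ge>) (map (\<lambda>j. A $$ (i, j)) ([i..<dim_col A] @ [0..<i])))"

definition kappa :: "real mat \<Rightarrow> nat \<Rightarrow> nat \<Rightarrow> nat" where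
  "kappa A i j =
     (if (j = 0 \<and> A $$ (i, dim_col A - 1) > A $$ (i, 0)) \<or>
         (1 \<le> j \<and> j < dim_col A \<and> A $$ (i, j - 1) > A $$ (i, j))
      then 1 else 0)"

definition mat_digraph :: "real mat \<Rightarrow> (nat, nat \<times> nat) pre_digraph" where
  "mat_digraph A =
     \<lparr>verts = {0..<dim_row A},
      arcs = {(i, j). i < dim_row A \<and> j < dim_row A \<and> kappa A i j = 1},
      tail = fst, head = snd\<rparr>"

definition strongly_connected_rel :: "('a, 'b) pre_digraph \<Rightarrow> ('a \<times> 'a) set" where
  "strongly_connected_rel G =
     {(u, v). u \<in> verts G \<and> v \<in> verts G \<and> (u = v \<or> (u \<rightarrow>\<^sup>*\<^bsub>G\<^esub> v \<and> v \<rightarrow>\<^sup>*\<^bsub>G\<^esub> u))}"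

definition scc_classes :: "('a, 'b) pre_digraph \<Rightarrow> 'a set set" where
  "scc_classes G = verts G // strongly_connected_rel G"

definition open_scc :: "('a, 'b) pre_digraph \<Rightarrow> 'a set \<Rightarrow> bool" where
  "open_scc G C \<longleftrightarrow> C \<in> scc_classes G \<and> (\<exists>u \<in> C. \<exists>v \<in> verts G - C. u \<rightarrow>\<^bsub>G\<^esub> v)"

definition closed_scc :: "('a, 'b) pre_digraph \<Rightarrow> 'a set \<Rightarrow> bool" where
  "closed_scc G C \<longleftrightarrow> C \<in> scc_classes G \<and> \<not> open_scc G C"

lemma wf_digraph_mat_digraph: "wf_digraph (mat_digraph A)"
  by unfold_locales (auto simp: mat_digraph_def)

lemma equiv_strongly_connected_rel: "equiv (verts G) (strongly_connected_rel G)"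
proof (rule equivI)
  show "strongly_connected_rel G \<subseteq> verts G \<times> verts G"
    by (auto simp: strongly_connected_rel_def)
  show "refl_on (verts G) (strongly_connected_rel G)"
    by (auto simp: refl_on_def strongly_connected_rel_def)
  show "sym (strongly_connected_rel G)"
    by (auto simp: sym_def strongly_connected_rel_def)
  show "trans (strongly_connected_rel G)"
    unfolding trans_def strongly_connected_rel_def reachable_def
    by (auto intro: rtrancl_on_trans)
qed

text \<open>The classes are the vertex sets of the library's strongly connected components.\<close>

lemma scc_classes_eq_sccs_verts:
  assumes "wf_digraph G"
  shows "scc_classes G = pre_digraph.sccs_verts G"
proof -
  interpret wf_digraph G by fact
  have rel: "(u, v) \<in> strongly_connected_rel G \<longleftrightarrow> u \<rightarrow>\<^sup>*\<^bsub>G\<^esub> v \<and> v \<rightarrow>\<^sup>*\<^bsub>G\<^esub> u" for u v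
    by (auto simp: strongly_connected_rel_def dest: reachable_in_verts)
  show ?thesis
  proof (intro equalityI subsetI)
    fix C assume "C \<in> scc_classes G"
    then obtain u where "u \<in> verts G" "C = strongly_connected_rel G `` {u}"
      by (auto simp: scc_classes_def elim: quotientE)
    moreover have "strongly_connected_rel G `` {u} = {v. u \<rightarrow>\<^sup>*\<^bsub>G\<^esub> v \<and> v \<rightarrow>\<^sup>*\<^bsub>G\<^esub> u}"
      by (auto simp: rel)
    ultimately show "C \<in> sccs_verts"
      unfolding in_sccs_verts_conv_reachable
      by (auto intro: reachable_trans)
  next
    fix C assume C: "C \<in> sccs_verts"
    then obtain u where u: "u \<in> C"
      by (auto simp: in_sccs_verts_conv_reachable)
    with C have "C = {v. u \<rightarrow>\<^sup>*\<^bsub>G\<^esub> v \<and> v \<rightarrow>\<^sup>*\<^bsub>G\<^esub> u}" and "u \<rightarrow>\<^sup>*\<^bsub>G\<^esub> u"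
      by (auto simp: in_sccs_verts_conv_reachable)
    moreover have "strongly_connected_rel G `` {u} = {v. u \<rightarrow>\<^sup>*\<^bsub>G\<^esub> v \<and> v \<rightarrow>\<^sup>*\<^bsub>G\<^esub> u}"
      by (auto simp: rel)
    ultimately show "C \<in> scc_classes G"
      unfolding scc_classes_def by (metis quotientI reachable_in_verts(1))
  qed
qed

text \<open>Vector counterpart of submatrix: pick I i is the i-th smallest element of I, counted from 0.\<close>

definition subvec :: "'a vec \<Rightarrow> nat set \<Rightarrow> 'a vec" where
  "subvec x I = vec (card {i. i < dim_vec x \<and> i \<in> I}) (\<lambda>i. x $ pick I i)"

definition ones_vec :: "nat \<Rightarrow> real vec" where
  "ones_vec n = vec n (\<lambda>_. 1)"

definition scc_system_solution :: "real mat \<Rightarrow> nat set \<Rightarrow> real vec \<Rightarrow> bool" where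
  "scc_system_solution A C x \<longleftrightarrow>
     transpose_mat (submatrix A C C) *\<^sub>v subvec x C = subvec (ones_vec (dim_row A)) C \<and>
     subvec x ({0..<dim_row A} - C) = 0\<^sub>v (card ({0..<dim_row A} - C))"

definition fundamental_scc :: "real mat \<Rightarrow> nat set \<Rightarrow> bool" where
  "fundamental_scc A C \<longleftrightarrow> closed_scc (mat_digraph A) C \<and>
     (\<exists>x \<in> carrier_vec (dim_row A). scc_system_solution A C x)"

definition null_scc :: "real mat \<Rightarrow> nat set \<Rightarrow> bool" where
  "null_scc A C \<longleftrightarrow> closed_scc (mat_digraph A) C \<and>
     \<not> (\<exists>x \<in> carrier_vec (dim_row A). scc_system_solution A C x)"

end

theory Submission
  imports Defs
begin

text \<open>
  Subtracting each column of \<open>A\<close> from its cyclic predecessor gives a matrix \<open>B\<close> with zero row sums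
  whose positive off-diagonal entries are the edges of the digraph. If \<open>C\<close> is closed, the rows of
  \<open>B\<close> in \<open>C\<close> are supported on \<open>C\<close>, so the indicator of \<open>C\<close> shows that the principal block of
  \<open>B\<close> on \<open>C\<close> is singular; hence some nonzero \<open>y\<close> supported on \<open>C\<close> satisfies \<open>y\<^sup>T B = 0\<close>, that is,
  \<open>y\<^sup>T A\<close> is a constant row. If \<open>A\<close> is invertible this constant is nonzero, and rescaling gives
  \<open>x\<close> supported on \<open>C\<close> with \<open>x\<^sup>T A = e\<^sup>T\<close>. Thus every closed component is fundamental, and two of
  them would yield two solutions with disjoint supports, although the solution is unique.
\<close>

section \<open>Cyclic differences and the edges of the digraph\<close>

definition cyclic_pred :: "nat \<Rightarrow> nat \<Rightarrow> nat" where
  "cyclic_pred n j = (if j = 0 then n - 1 else j - 1)"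

text \<open>These are the entries of \<open>B\<close>. The sign is chosen so that, for
  \<open>j < dim_col A\<close>, a positive entry is exactly the condition for
  \<open>kappa A i j = 1\<close>.\<close>

definition cyclic_diff :: "real mat \<Rightarrow> nat \<Rightarrow> nat \<Rightarrow> real" where
  "cyclic_diff A i j = A $$ (i, cyclic_pred (dim_col A) j) - A $$ (i, j)"

lemma sum_cyclic_pred:
  fixes f :: "nat \<Rightarrow> 'a::comm_monoid_add"
  shows "(\<Sum>j<n. f (cyclic_pred n j)) = (\<Sum>j<n. f j)"
proof (cases n)
  case (Suc m)
  have "(\<Sum>j<Suc m. f (cyclic_pred (Suc m) j)) = f m + (\<Sum>j<m. f j)"
    by (subst sum.lessThan_Suc_shift) (simp add: cyclic_pred_def)
  then show ?thesis
    using Suc by (simp add: add.commute)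
qed simp

lemma sum_cyclic_diff: "(\<Sum>j<dim_col A. cyclic_diff A i j) = 0"
  using sum_cyclic_pred[of "\<lambda>j. A $$ (i, j)" "dim_col A"]
  by (simp add: cyclic_diff_def sum_subtractf)

lemma eq_cyclic_pred_imp_constant:
  assumes "\<And>j. j < n \<Longrightarrow> f (cyclic_pred n j) = f j" and "j < n"
  shows "f j = f 0"
  using assms(2)
proof (induction j)
  case (Suc j)
  then show ?case
    using assms(1)[of "Suc j"] by (simp add: cyclic_pred_def)
qed simp

text \<open>The chain of row \<open>i\<close> starts at the diagonal, so the cyclic step into column
  \<open>j\<close> follows the chain unless \<open>j = i\<close>, where it jumps from the end of the
  chain back to its start.\<close>

lemma cyclic_diff_nonneg:
  assumes "A \<in> carrier_mat n n" "cyclically_decreasing_rows A"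
    and "i < n" "j < n" "i \<noteq> j"
  shows "cyclic_diff A i j \<ge> 0"
proof -
  let ?f = "\<lambda>j. A $$ (i, j)"
  have sorted: "sorted_wrt (\<ge>) (map ?f ([i..<n] @ [0..<i]))"
    using assms(1-3) by (auto simp: cyclically_decreasing_rows_def)
  \<comment> \<open>The chain consists of the segments \<open>[i..<n]\<close> and
    \<open>[0..<i]\<close>: \<open>le\<close> compares columns within one segment,
    \<open>wrap\<close> compares across the junction.\<close>
  have le: "?f l \<le> ?f k" if "k < l" "i \<le> k \<and> l < n \<or> l < i" for k l
  proof -
    have mono: "?f (b + q) \<le> ?f (b + p)"
      if "sorted_wrt (\<ge>) (map ?f [b..<c])" "p < q" "b + q < c" for b c p q
      using that by (auto simp: sorted_wrt_iff_nth_less)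
    from that(2) show ?thesis
    proof
      assume "i \<le> k \<and> l < n"
      then show ?thesis
        using sorted that(1) mono[of i n "k - i" "l - i"]
        by (simp add: sorted_wrt_append diff_less_mono)
    next
      assume "l < i"
      then show ?thesis
        using sorted that(1) mono[of 0 i k l] by (simp add: sorted_wrt_append)
    qed
  qed
  have wrap: "?f l \<le> ?f k" if "i \<le> k" "k < n" "l < i" for k l
    using sorted that by (auto simp: sorted_wrt_append)
  have "?f j \<le> ?f (cyclic_pred n j)"
  proof (cases "j = 0")
    case True
    then show ?thesis
      \<comment> \<open>Here \<open>i \<noteq> j\<close> gives \<open>0 < i\<close>, so the second
        segment is nonempty and starts with column 0.\<close>
      using wrap[of "n - 1" 0] assms(3,5) by (simp add: cyclic_pred_def)
  next
    case False
    then have "i \<le> j - 1 \<and> j < n \<or> j < i"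
      using assms(4,5) by linarith
    then show ?thesis
      using le[of "j - 1" j] False by (simp add: cyclic_pred_def)
  qed
  then show ?thesis
    using assms(1) by (simp add: cyclic_diff_def)
qed

lemma cyclic_diff_pos_imp_arc:
  assumes "A \<in> carrier_mat n n" "i < n" "j < n" "cyclic_diff A i j > 0"
  shows "i \<rightarrow>\<^bsub>mat_digraph A\<^esub> j"
proof -
  have "kappa A i j = 1"
    using assms by (cases "j = 0") (auto simp: kappa_def cyclic_diff_def cyclic_pred_def)
  then have "(i, j) \<in> arcs (mat_digraph A)"
    using assms by (simp add: mat_digraph_def)
  then show ?thesis
    by (auto simp: arcs_ends_def arc_to_ends_def mat_digraph_def image_iff)
qed

text \<open>Such an entry is off the diagonal, hence nonnegative; were it positive, it would be an
  edge leaving \<open>C\<close>.\<close>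

lemma closed_scc_cyclic_diff_eq_0:
  assumes A: "A \<in> carrier_mat n n" and dec: "cyclically_decreasing_rows A"
    and C: "closed_scc (mat_digraph A) C" "C \<subseteq> {..<n}"
    and "i \<in> C" "j < n" "j \<notin> C"
  shows "cyclic_diff A i j = 0"
proof (rule ccontr)
  assume neq: "cyclic_diff A i j \<noteq> 0"
  have i: "i < n" "i \<noteq> j"
    using assms by auto
  have "cyclic_diff A i j > 0"
    using cyclic_diff_nonneg[OF A dec i(1) \<open>j < n\<close> i(2)] neq by simp
  then have "i \<rightarrow>\<^bsub>mat_digraph A\<^esub> j"
    using cyclic_diff_pos_imp_arc[OF A i(1) \<open>j < n\<close>] by simp
  moreover have "j \<in> verts (mat_digraph A) - C"
    using A \<open>j < n\<close> \<open>j \<notin> C\<close> by (simp add: mat_digraph_def)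
  ultimately show False
    using C(1) \<open>i \<in> C\<close> by (auto simp: closed_scc_def open_scc_def)
qed

lemma closed_scc_nonempty_subset:
  assumes "A \<in> carrier_mat n n" "closed_scc (mat_digraph A) C"
  shows "C \<noteq> {}" "C \<subseteq> {..<n}"
proof -
  have C: "C \<in> verts (mat_digraph A) // strongly_connected_rel (mat_digraph A)"
    using assms(2) by (simp add: closed_scc_def scc_classes_def)
  show "C \<noteq> {}"
    using in_quotient_imp_non_empty[OF equiv_strongly_connected_rel C] .
  show "C \<subseteq> {..<n}"
    using in_quotient_imp_subset[OF equiv_strongly_connected_rel C] assms(1)
    by (auto simp: mat_digraph_def)
qed

section \<open>Null vectors and invertibility\<close>

text \<open>Transposition preserves the determinant, so the right null vector given by the indicator
  of \<open>C\<close> yields a left null vector.\<close>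

lemma exists_left_null_vector:
  fixes B :: "nat \<Rightarrow> nat \<Rightarrow> 'a::field"
  assumes C: "C \<noteq> {}" "C \<subseteq> {..<n}"
    and supp: "\<And>i j. i \<in> C \<Longrightarrow> j < n \<Longrightarrow> j \<notin> C \<Longrightarrow> B i j = 0"
    and row_sum: "\<And>i. i \<in> C \<Longrightarrow> (\<Sum>j<n. B i j) = 0"
  obtains y where "y \<in> carrier_vec n" "y \<noteq> 0\<^sub>v n" "\<And>i. i < n \<Longrightarrow> i \<notin> C \<Longrightarrow> y $ i = 0"
    "\<And>j. j < n \<Longrightarrow> (\<Sum>i<n. B i j * y $ i) = 0"
proof -
  \<comment> \<open>The block of \<open>B\<close> on \<open>C\<close>, padded by the identity, avoids working with a submatrix.\<close>
  define M where "M = mat n n (\<lambda>(i, j). if i \<in> C then B i j else if i = j then 1 else 0)"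
  define v where "v = vec n (\<lambda>j. if j \<in> C then 1 else 0 :: 'a)"
  have M: "M \<in> carrier_mat n n" and v: "v \<in> carrier_vec n"
    by (simp_all add: M_def v_def)
  obtain c where "c \<in> C" "c < n"
    using C by auto
  then have "v $ c \<noteq> 0\<^sub>v n $ c"
    by (simp add: v_def)
  then have v0: "v \<noteq> 0\<^sub>v n"
    by metis
  have "M *\<^sub>v v = 0\<^sub>v n"
  proof (rule eq_vecI)
    fix i assume "i < dim_vec (0\<^sub>v n)"
    then have i: "i < n" by simp
    have "(M *\<^sub>v v) $ i = (\<Sum>j<n. M $$ (i, j) * v $ j)"
      using i M v by (simp add: scalar_prod_def atLeast0LessThan)
    also have "\<dots> = (if i \<in> C then (\<Sum>j<n. B i j) else 0)"
    proof (cases "i \<in> C")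
      case True
      then have "(\<Sum>j<n. M $$ (i, j) * v $ j) = (\<Sum>j<n. B i j)"
        by (intro sum.cong) (auto simp: M_def v_def i supp)
      then show ?thesis using True by simp
    next
      case False
      then have "(\<Sum>j<n. M $$ (i, j) * v $ j) = 0"
        by (intro sum.neutral) (auto simp: M_def v_def i)
      then show ?thesis using False by simp
    qed
    also have "\<dots> = 0"
      using row_sum by simp
    finally show "(M *\<^sub>v v) $ i = 0\<^sub>v n $ i"
      using i by simp
  qed (simp add: M_def)
  then have "det (M\<^sup>T) = 0"
    using det_0_iff_vec_prod_zero[OF M] v v0 det_transpose[OF M] by auto
  then obtain y where y: "y \<in> carrier_vec n" "y \<noteq> 0\<^sub>v n" "M\<^sup>T *\<^sub>v y = 0\<^sub>v n"
    using det_0_iff_vec_prod_zero[of "M\<^sup>T" n] M by auto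
  have col: "(\<Sum>i<n. M $$ (i, j) * y $ i) = 0" if "j < n" for j
  proof -
    have "(M\<^sup>T *\<^sub>v y) $ j = (\<Sum>i<n. M $$ (i, j) * y $ i)"
      using that M y(1) by (simp add: scalar_prod_def atLeast0LessThan)
    then show ?thesis
      using y(3) that by simp
  qed
  \<comment> \<open>For \<open>j\<close> outside \<open>C\<close>, the rows of \<open>M\<close> in
    \<open>C\<close> vanish at \<open>j\<close> and the other rows are identity rows, so the column
    equation reduces to \<open>y $ j = 0\<close>.\<close>
  have outside: "y $ j = 0" if "j < n" "j \<notin> C" for j
  proof -
    have "(\<Sum>i<n. M $$ (i, j) * y $ i) = (\<Sum>i<n. if i = j then y $ i else 0)"
      using that by (intro sum.cong) (auto simp: M_def supp)
    then show ?thesis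
      using col[OF that(1)] that(1) by simp
  qed
  have "(\<Sum>i<n. B i j * y $ i) = 0" if "j < n" for j
  proof -
    have "(\<Sum>i<n. B i j * y $ i) = (\<Sum>i<n. M $$ (i, j) * y $ i)"
      using that by (intro sum.cong) (auto simp: M_def outside)
    then show ?thesis
      using col[OF that] by simp
  qed
  with y(1,2) outside show thesis
    by (rule that)
qed

lemma invertible_mat_transpose_mult_inj:
  fixes A :: "'a::comm_ring_1 mat"
  assumes A: "A \<in> carrier_mat n n" and inv: "invertible_mat A"
    and x: "x \<in> carrier_vec n" and y: "y \<in> carrier_vec n" and eq: "A\<^sup>T *\<^sub>v x = A\<^sup>T *\<^sub>v y"
  shows "x = y"
proof -
  obtain B where AB: "A * B = 1\<^sub>m (dim_row A)" and BA: "B * A = 1\<^sub>m (dim_row B)"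
    using inv by (auto simp: invertible_mat_def inverts_mat_def)
  \<comment> \<open>The inverse comes without a size; the two products determine it.\<close>
  have "dim_col B = n" "dim_row B = n"
    using AB BA A by (metis carrier_matD index_mult_mat(2,3) index_one_mat(2,3))+
  then have B: "B \<in> carrier_mat n n"
    by auto
  have "B\<^sup>T * A\<^sup>T = (A * B)\<^sup>T"
    using transpose_mult[OF A B] by simp
  then have BTAT: "B\<^sup>T * A\<^sup>T = 1\<^sub>m n"
    using AB A by simp
  have "z = B\<^sup>T *\<^sub>v (A\<^sup>T *\<^sub>v z)" if "z \<in> carrier_vec n" for z
  proof -
    have "(B\<^sup>T * A\<^sup>T) *\<^sub>v z = B\<^sup>T *\<^sub>v (A\<^sup>T *\<^sub>v z)"
      using A B that by (intro assoc_mult_mat_vec) auto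
    then show ?thesis
      using BTAT that by simp
  qed
  then show ?thesis
    using x y eq by metis
qed

lemma exists_supported_solution:
  assumes A: "A \<in> carrier_mat n n" and dec: "cyclically_decreasing_rows A"
    and C: "closed_scc (mat_digraph A) C" and inv: "invertible_mat A"
  obtains x where "x \<in> carrier_vec n" "\<And>i. i < n \<Longrightarrow> i \<notin> C \<Longrightarrow> x $ i = 0"
    "A\<^sup>T *\<^sub>v x = ones_vec n"
proof -
  note C_sub = closed_scc_nonempty_subset[OF A C]
  obtain y where y: "y \<in> carrier_vec n" "y \<noteq> 0\<^sub>v n" "\<And>i. i < n \<Longrightarrow> i \<notin> C \<Longrightarrow> y $ i = 0"
    and null: "\<And>j. j < n \<Longrightarrow> (\<Sum>i<n. cyclic_diff A i j * y $ i) = 0"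
  proof (rule exists_left_null_vector[OF C_sub, where B = "cyclic_diff A"])
    show "cyclic_diff A i j = 0" if "i \<in> C" "j < n" "j \<notin> C" for i j
      using closed_scc_cyclic_diff_eq_0[OF A dec C C_sub(2) that] .
    show "(\<Sum>j<n. cyclic_diff A i j) = 0" if "i \<in> C" for i
      using sum_cyclic_diff[of A i] A by simp
  qed blast
  \<comment> \<open>\<open>g\<close> is the row \<open>y\<close>-transpose times \<open>A\<close>;
    that \<open>y\<close> annihilates \<open>B\<close> from the left means that \<open>g\<close>
    takes the same value at \<open>j\<close> and at its cyclic predecessor.\<close>
  define g where "g j = (\<Sum>i<n. A $$ (i, j) * y $ i)" for j
  have "g (cyclic_pred n j) = g j" if "j < n" for j
    using null[OF that] A
    by (simp add: g_def cyclic_diff_def left_diff_distrib sum_subtractf)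
  then have const: "g j = g 0" if "j < n" for j
    using eq_cyclic_pred_imp_constant[of n g j] that by blast
  have ATy: "A\<^sup>T *\<^sub>v y = g 0 \<cdot>\<^sub>v ones_vec n"
  proof (rule eq_vecI)
    fix j assume "j < dim_vec (g 0 \<cdot>\<^sub>v ones_vec n)"
    then have j: "j < n" by (simp add: ones_vec_def)
    then have "(A\<^sup>T *\<^sub>v y) $ j = g j"
      using A y(1) by (simp add: scalar_prod_def atLeast0LessThan g_def)
    then show "(A\<^sup>T *\<^sub>v y) $ j = (g 0 \<cdot>\<^sub>v ones_vec n) $ j"
      using const[OF j] j by (simp add: ones_vec_def)
  qed (use A in \<open>simp add: ones_vec_def\<close>)
  \<comment> \<open>Otherwise the nonzero \<open>y\<close> would be sent to zero by the injective
    transpose of \<open>A\<close>.\<close>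
  have "g 0 \<noteq> 0"
  proof
    assume "g 0 = 0"
    then have "A\<^sup>T *\<^sub>v y = 0\<^sub>v n"
      using ATy by (auto simp: ones_vec_def)
    moreover have "A\<^sup>T *\<^sub>v 0\<^sub>v n = 0\<^sub>v n"
      using A by (intro eq_vecI) auto
    ultimately show False
      using invertible_mat_transpose_mult_inj[OF A inv y(1), of "0\<^sub>v n"] y(2) by simp
  qed
  have "A\<^sup>T *\<^sub>v ((1 / g 0) \<cdot>\<^sub>v y) = (1 / g 0) \<cdot>\<^sub>v (A\<^sup>T *\<^sub>v y)"
    using A y(1) by (intro mult_mat_vec) auto
  also have "\<dots> = ones_vec n"
    using ATy \<open>g 0 \<noteq> 0\<close> by (simp add: smult_smult_assoc)
  finally show thesis
    using y(1,3) by (intro that[of "(1 / g 0) \<cdot>\<^sub>v y"]) auto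
qed

section \<open>Restriction to the block system on \<open>C\<close>\<close>

lemma pick_bij_betw:
  assumes "finite S"
  shows "bij_betw (pick S) {..<card S} S"
proof (rule bij_betw_imageI)
  show inj: "inj_on (pick S) {..<card S}"
    by (rule linorder_inj_onI') (use pick_mono_le in fastforce)
  have "pick S ` {..<card S} \<subseteq> S"
    using pick_in_set_le by auto
  then show "pick S ` {..<card S} = S"
    using assms by (intro card_subset_eq) (simp_all add: card_image[OF inj])
qed

text \<open>Since \<open>x\<close> vanishes off \<open>C\<close>, each equation of the full system
  indexed by \<open>C\<close> involves only columns of the transpose indexed by \<open>C\<close>,
  and so is an equation of the block system.\<close>

lemma scc_system_solutionI:
  assumes A: "A \<in> carrier_mat n n" and C: "C \<subseteq> {..<n}" and x: "x \<in> carrier_vec n"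
    and supp: "\<And>i. i < n \<Longrightarrow> i \<notin> C \<Longrightarrow> x $ i = 0" and sol: "A\<^sup>T *\<^sub>v x = ones_vec n"
  shows "scc_system_solution A C x"
proof -
  have fin: "finite C"
    using C finite_subset by blast
  have C_eq: "{i. i < n \<and> i \<in> C} = C"
    using C by auto
  have pick: "pick C p \<in> C" "pick C p < n" if "p < card C" for p
    using pick_in_set_le[OF that] C by auto
  have "transpose_mat (submatrix A C C) *\<^sub>v subvec x C = subvec (ones_vec (dim_row A)) C"
    (is "?l = ?r")
  proof (rule eq_vecI)
    fix p assume "p < dim_vec ?r"
    then have p: "p < card C"
      using A C_eq by (simp add: subvec_def ones_vec_def)
    have "?l $ p = (\<Sum>q<card C. A $$ (pick C q, pick C p) * x $ pick C q)"
      using p A x C_eq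
      by (simp add: scalar_prod_def atLeast0LessThan subvec_def submatrix_def)
    \<comment> \<open>Positions in the submatrix are translated back to the original indices, so
      that the sum can be extended by zero terms to all \<open>i < n\<close>.\<close>
    also have "\<dots> = (\<Sum>i\<in>C. A $$ (i, pick C p) * x $ i)"
      using sum.reindex_bij_betw[OF pick_bij_betw[OF fin]] .
    also have "\<dots> = (\<Sum>i<n. A $$ (i, pick C p) * x $ i)"
      using C supp by (intro sum.mono_neutral_left) auto
    also have "\<dots> = (A\<^sup>T *\<^sub>v x) $ pick C p"
      using A x pick(2)[OF p] by (simp add: scalar_prod_def atLeast0LessThan)
    also have "\<dots> = ?r $ p"
      using sol A p pick(2)[OF p] C_eq by (simp add: subvec_def ones_vec_def)
    finally show "?l $ p = ?r $ p" .
  qed (use A C_eq in \<open>simp add: subvec_def submatrix_def ones_vec_def\<close>)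
  moreover have "subvec x ({0..<n} - C) = 0\<^sub>v (card ({0..<n} - C))"
  proof -
    have "{i. i < n \<and> i \<in> {0..<n} - C} = {0..<n} - C"
      by auto
    moreover have "x $ pick ({0..<n} - C) p = 0" if "p < card ({0..<n} - C)" for p
      using pick_in_set_le[OF that] supp by auto
    ultimately show ?thesis
      using x by (intro eq_vecI) (simp_all add: subvec_def)
  qed
  ultimately show ?thesis
    using A by (simp add: scc_system_solution_def)
qed

section \<open>Contradiction with invertibility\<close>

lemma invertible_closed_scc_unique:
  assumes A: "A \<in> carrier_mat n n" and dec: "cyclically_decreasing_rows A"
    and inv: "invertible_mat A"
    and C: "closed_scc (mat_digraph A) C" and D: "closed_scc (mat_digraph A) D"
  shows "C = D"
proof (rule ccontr)
  assume "C \<noteq> D"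
  then have disj: "C \<inter> D = {}"
    using quotient_disj[OF equiv_strongly_connected_rel] C D
    unfolding closed_scc_def scc_classes_def by blast
  obtain x where x: "x \<in> carrier_vec n" "\<And>i. i < n \<Longrightarrow> i \<notin> C \<Longrightarrow> x $ i = 0"
    "A\<^sup>T *\<^sub>v x = ones_vec n"
    using exists_supported_solution[OF A dec C inv] by blast
  obtain y where y: "y \<in> carrier_vec n" "\<And>i. i < n \<Longrightarrow> i \<notin> D \<Longrightarrow> y $ i = 0"
    "A\<^sup>T *\<^sub>v y = ones_vec n"
    using exists_supported_solution[OF A dec D inv] by blast
  have "x = y"
    using invertible_mat_transpose_mult_inj[OF A inv x(1) y(1)] x(3) y(3) by simp
  \<comment> \<open>The common solution is supported on both \<open>C\<close> and \<open>D\<close>,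
    which are disjoint as distinct equivalence classes.\<close>
  then have "x $ i = 0" if "i < n" for i
    using x(2) y(2) disj that by (cases "i \<in> C") auto
  then have "x = 0\<^sub>v n"
    using x(1) by (intro eq_vecI) auto
  then have "A\<^sup>T *\<^sub>v x = 0\<^sub>v n"
    using A by (intro eq_vecI) auto
  \<comment> \<open>The zero vector and the all-ones vector differ only in positive dimension; the
    nonempty class \<open>C\<close> provides an index.\<close>
  moreover have "0 < n"
    using closed_scc_nonempty_subset[OF A C] by (cases n) auto
  ultimately have "(0\<^sub>v n :: real vec) $ 0 = ones_vec n $ 0"
    using x(3) by simp
  with \<open>0 < n\<close> show False
    by (simp add: ones_vec_def)
qed

theorem theorem8:
  fixes A :: "real mat" and n :: nat
  assumes "A \<in> carrier_mat n n"
    and "cyclically_decreasing_rows A"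
    and "card {C. closed_scc (mat_digraph A) C} \<ge> 2 \<or>
         (\<exists>C. {D. closed_scc (mat_digraph A) D} = {C} \<and> null_scc A C)"
  shows "\<not> invertible_mat A"
proof
  assume inv: "invertible_mat A"
  from assms(3) show False
  proof
    assume "card {C. closed_scc (mat_digraph A) C} \<ge> 2"
    \<comment> \<open>An infinite set has \<open>card\<close> 0, so the bound also gives the
      finiteness needed to extract two distinct elements.\<close>
    then obtain C D where "closed_scc (mat_digraph A) C" "closed_scc (mat_digraph A) D" "C \<noteq> D"
      using card_le_Suc0_iff_eq[of "{C. closed_scc (mat_digraph A) C}"]
      by (metis (no_types, lifting) One_nat_def Suc_1 card.infinite mem_Collect_eq
          not_less_eq_eq zero_le)
    then show False
      using invertible_closed_scc_unique[OF assms(1,2) inv] by blast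
  next
    assume "\<exists>C. {D. closed_scc (mat_digraph A) D} = {C} \<and> null_scc A C"
    then obtain C where "null_scc A C"
      by blast
    then have C: "closed_scc (mat_digraph A) C"
      and no: "\<not> (\<exists>x \<in> carrier_vec n. scc_system_solution A C x)"
      using assms(1) by (auto simp: null_scc_def)
    obtain x where "x \<in> carrier_vec n" "\<And>i. i < n \<Longrightarrow> i \<notin> C \<Longrightarrow> x $ i = 0"
      "A\<^sup>T *\<^sub>v x = ones_vec n"
      using exists_supported_solution[OF assms(1,2) C inv] by blast
    with no show False
      using scc_system_solutionI[OF assms(1) closed_scc_nonempty_subset(2)[OF assms(1) C]] by blast
  qed
qed

end
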